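(* Let $f,g\in\mathbb{K}[x]$ be monic polynomials of degrees $m$ and $n$, with multisets of roots $A,B\subset\mathbb{K}$ respectively (so $f=\prod_{a\in A}(x-a)$, $g=\prod_{b\in B}(x-b)$, products with multiplicity). Let $\overline A$ and $\overline B$ be subsets of the sets of distinct roots of $f$ and $g$, respectively, with $\overline m=|\overline A|$ and $\overline n=|\overline B|$, and set $m':=m-\overline m$ and $n':=n-\overline n$. For any $d$ such that $m'+n'\le d<\min\{m,n\}$, we have $$F_d(f,g)(x)=(-1)^{m-d+n'(\overline m-1)}\sum_{\substack{A'\subset\overline A\\|A'|=n'}}\ \sum_{\substack{B'\subset\overline B\\|B'|=d+1-n'}}\frac{\mathcal{R}(A\backslash\overline A,\overline B\backslash B')\,\mathcal{R}(\overline A\backslash A',B\backslash B')\,\mathcal{R}(x,\overline B\backslash B')}{\mathcal{R}(A',\overline A\backslash A')\,\mathcal{R}(B',\overline B\backslash B')},$$ $$G_d(f,g)(x)=(-1)^{(d-m')(m-d-1)}\sum_{\substack{A'\subset\overline A\\|A'|=d+1-m'}}\ \sum_{\substack{B'\subset\overline B\\|B'|=m'}}\frac{\mathcal{R}(\overline A\backslash A',B\backslash\overline B)\,\mathcal{R}(A\backslash A',\overline B\backslash B')\,\mathcal{R}(x,\overline A\backslash A')}{\mathcal{R}(A',\overline A\backslash A')\,\mathcal{R}(B',\overline B\backslash B')}.$$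
   Context: $\mathbb{K}$ is a field. For a multiset $X$, $|X|$ is the number of elements counted with multiplicity; for multisets $X'\subset X$, $X\backslash X'$ is the multiset difference (multiplicities subtracted). For multisets $X,Y$, $\mathcal{R}(X,Y):=\prod_{x\in X,\,y\in Y}(x-y)$ (with multiplicities), equal to $1$ if $X$ or $Y$ is empty; $\mathcal{R}(x,Y):=\mathcal{R}(\{x\},Y)$. For $f=f_mx^m+\cdots+f_0$, $g=g_nx^n+\cdots+g_0$ and $0\le d<\min\{m,n\}$, $F_d(f,g)(x)$ and $G_d(f,g)(x)$ are determinants of square matrices of size $m+n-2d$ (coefficients with index outside the range are $0$). In both matrices, for $1\le j\le m+n-2d-1$, column $j$ has entry $f_{m+i-j}$ in row $i$ for $1\le i\le n-d$, and entry $g_{n+i-j}$ in row $n-d+i$ for $1\le i\le m-d$. The last column is, for $F_d$: entry $x^{n-d-i}$ in row $i$ for $1\le i\le n-d$, and $0$ in the remaining $m-d$ rows; for $G_d$: entry $0$ in the first $n-d$ rows, and $x^{m-d-i}$ in row $n-d+i$ for $1\le i\le m-d$. (Thus $F_d f+G_d g$ is the $d$-th subresultant of $f$ and $g$.) *)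

theory Defs
  imports
    "HOL-Library.Multiset"
    "HOL-Computational_Algebra.Polynomial"
    "Jordan_Normal_Form.Determinant"
begin

definition mset_res :: "'a::comm_ring_1 multiset \<Rightarrow> 'a multiset \<Rightarrow> 'a" where
  "mset_res X Y = (\<Prod>x\<in>#X. \<Prod>y\<in>#Y. x - y)"

text \<open>For the indeterminate x in the first argument, the product is formed in the polynomial
  ring, the elements of Y being read as constant polynomials.\<close>

definition mset_res_var :: "'a::comm_ring_1 multiset \<Rightarrow> 'a poly" where
  "mset_res_var Y = mset_res {#[:0, 1:]#} (image_mset (\<lambda>y. [:y:]) Y)"

text \<open>Rows and columns of matrices are numbered from 0, so row i and column j below are row i + 1
  and column j + 1 of the usual description; the difference of the two indices is unaffected.
  The guards on j replace the convention that coefficients with negative index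
  vanish; coefficients above
  the degree vanish by definition of coeff. The argument c gives the last column.\<close>

definition subres_mat ::
  "nat \<Rightarrow> 'a::comm_ring_1 poly \<Rightarrow> 'a poly \<Rightarrow> (nat \<Rightarrow> 'a poly) \<Rightarrow> 'a poly mat" where
  "subres_mat d f g c =
    (let m = degree f; n = degree g; N = m + n - 2 * d in
     mat N N (\<lambda>(i, j).
       if j = N - 1 then c i
       else if i < n - d then (if j \<le> m + i then [:coeff f (m + i - j):] else 0)
       else (let k = i - (n - d) in if j \<le> n + k then [:coeff g (n + k - j):] else 0)))"

text \<open>The cofactors F and G are meant for d below both degrees; then F_cof d f g * f + G_cof d f g * g
  is the d-th subresultant of f and g.\<close>

definition F_cof :: "nat \<Rightarrow> 'a::comm_ring_1 poly \<Rightarrow> 'a poly \<Rightarrow> 'a poly" where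
  "F_cof d f g = det (subres_mat d f g
     (\<lambda>i. if i < degree g - d then monom 1 (degree g - d - 1 - i) else 0))"

definition G_cof :: "nat \<Rightarrow> 'a::comm_ring_1 poly \<Rightarrow> 'a poly \<Rightarrow> 'a poly" where
  "G_cof d f g = det (subres_mat d f g
     (\<lambda>i. if i < degree g - d then 0
          else monom 1 (degree f - d - 1 - (i - (degree g - d)))))"

end

theory Submission
  imports Defs
begin

text \<open>
  Both cofactors are, up to sign, principal subresultant coefficients with one additional root.
  Subtracting \<open>x\<close> times the next row from each row that comes from \<open>f\<close>,
  except the last of them, clears the last column of the matrix of \<open>F\<close> except for a single 1, and what remains after expansion is
  the matrix of the \<open>(d + 1)\<close>-st principal subresultant coefficient of
  \<open>(y - x) f(y)\<close> and \<open>g(y)\<close>. Symmetrically, \<open>G\<close> becomes the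
  coefficient of \<open>f(y)\<close> and \<open>(y - x) g(y)\<close>. So the roots \<open>x\<close>
  and \<open>A\<close> (respectively \<open>x\<close> and \<open>B\<close>) may be treated alike,
  and both identities are instances of one double-sum formula for the principal subresultant
  coefficient \<open>psc k A B\<close> of two multisets of roots: the second one with the two
  multisets exchanged, which explains the different shapes of the two sums and of their signs.

  The formula for \<open>psc\<close> follows from polynomial interpolation. Three facts suffice.
  A common factor of degree \<open>e\<close> lowers the order of the coefficient by \<open>e\<close>
  (\<open>psc_common_roots\<close>); at order 0 the coefficient is the resultant, the product of
  all differences of roots (\<open>psc_0\<close>); and \<open>psc k A B\<close> is a polynomial of
  degree at most \<open>|B| - k\<close> in each single element of \<open>A\<close>, and of degree at
  most \<open>|A| - k\<close> in each element of \<open>B\<close>. Two functions of a multiset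
  \<open>Y\<close> with \<open>r\<close> elements that have degree at most \<open>|X| - r\<close>
  in each element agree everywhere as soon as they agree at all \<open>r\<close>-element subsets of
  the set \<open>X\<close> (\<open>symmetric_interpolation\<close>).

  If \<open>B\<close> is a set, this is applied to \<open>k\<close> of the elements of \<open>A\<close>,
  interpolating at \<open>X = B\<close>. At a \<open>k\<close>-subset \<open>D\<close> of \<open>B\<close>
  the factor with roots \<open>D\<close> is common, only a resultant remains on the left, and all terms
  but one vanish in the candidate sum over subsets of \<open>B\<close>; this gives
  \<open>psc_single_sum\<close>. In general \<open>B\<close> is a set \<open>Bb\<close> together with
  a multiset \<open>B0\<close>, and the elements of \<open>B0\<close> are interpolated at
  \<open>X = Ab\<close>. Again the common roots cancel, the sum over subsets of \<open>Ab\<close>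
  collapses to one term, and the other sum is the single sum just found
  (\<open>psc_double_sum\<close>). The hypothesis \<open>m' + n' \<le> d\<close> is exactly the degree
  bound that this last interpolation requires.

  Both sides of the final identities have degree in \<open>x\<close> smaller than \<open>|Bb|\<close>
  (respectively \<open>|Ab|\<close>), hence comparing their values at elements of the field is enough
  even when the field is finite.
\<close>

section \<open>Determinants of coefficient matrices\<close>

lemma upper_unitriangular_det:
  fixes U :: "nat \<Rightarrow> nat \<Rightarrow> 'a::comm_ring_1"
  assumes "\<And>l j. j < l \<Longrightarrow> l < N \<Longrightarrow> U l j = 0" and "\<And>j. j < N \<Longrightarrow> U j j = 1"
  shows "det (mat N N (\<lambda>(i,j). U i j)) = 1"
proof -
  have "det (mat N N (\<lambda>(i,j). U i j)) = prod_list (diag_mat (mat N N (\<lambda>(i,j). U i j)))"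
    by (rule det_upper_triangular[of _ N]) (auto simp: assms upper_triangular_def)
  also have "\<dots> = 1"
    unfolding prod_list_diag_prod by (rule prod.neutral) (auto simp: assms)
  finally show ?thesis .
qed

lemma det_unitriangular_col_ops:
  fixes M M' U :: "nat \<Rightarrow> nat \<Rightarrow> 'a::comm_ring_1"
  assumes "\<And>i j. i < N \<Longrightarrow> j < N \<Longrightarrow> M' i j = (\<Sum>l<N. M i l * U l j)"
    and "\<And>l j. j < l \<Longrightarrow> l < N \<Longrightarrow> U l j = 0" and "\<And>j. j < N \<Longrightarrow> U j j = 1"
  shows "det (mat N N (\<lambda>(i,j). M' i j)) = det (mat N N (\<lambda>(i,j). M i j))"
proof -
  have "mat N N (\<lambda>(i,j). M' i j) = mat N N (\<lambda>(i,j). M i j) * mat N N (\<lambda>(i,j). U i j)"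
    by (intro eq_matI) (auto simp: assms(1) scalar_prod_def atLeast0LessThan)
  then show ?thesis
    using upper_unitriangular_det[of N U] assms(2,3) by (simp add: det_mult[of _ N])
qed

text \<open>When row \<open>i\<close> holds \<open>y ^ (e + 1)\<close> times a polynomial and the next row
  holds \<open>y ^ e\<close> times the same polynomial, this operation puts the factor
  \<open>y - c\<close> into row \<open>i\<close>.\<close>

lemma det_chained_row_ops:
  fixes M :: "nat \<Rightarrow> nat \<Rightarrow> 'a::comm_ring_1"
  assumes "\<And>i. i \<in> S \<Longrightarrow> Suc i < N"
  shows "det (mat N N (\<lambda>(i,j). M i j - (if i \<in> S then c * M (Suc i) j else 0)))
       = det (mat N N (\<lambda>(i,j). M i j))"
proof -
  define U where "U i l = (if l = i then 1 else if i \<in> S \<and> l = Suc i then - c else 0)" for i l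
  have "mat N N (\<lambda>(i,j). M i j - (if i \<in> S then c * M (Suc i) j else 0))
      = mat N N (\<lambda>(i,j). U i j) * mat N N (\<lambda>(i,j). M i j)"
  proof (intro eq_matI; clarsimp simp: scalar_prod_def atLeast0LessThan)
    fix i j assume ij: "i < N" "j < N"
    have "(\<Sum>l<N. U i l * M l j)
        = (\<Sum>l<N. (if l = i then M l j else 0) + (if l = Suc i then if i \<in> S then - c * M l j else 0 else 0))"
      by (intro sum.cong) (auto simp: U_def)
    also have "\<dots> = M i j - (if i \<in> S then c * M (Suc i) j else 0)"
      using ij assms[of i] by (simp add: sum.distrib)
    finally show "(i \<in> S \<longrightarrow> M i j - c * M (Suc i) j = (\<Sum>l<N. U i l * M l j)) \<and>
        (i \<notin> S \<longrightarrow> M i j = (\<Sum>l<N. U i l * M l j))"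
      by auto
  qed
  moreover have "det (mat N N (\<lambda>(i,j). U i j)) = 1"
    by (rule upper_unitriangular_det) (auto simp: U_def)
  ultimately show ?thesis
    by (simp add: det_mult[of _ N])
qed

lemma det_last_col_single:
  fixes M :: "nat \<Rightarrow> nat \<Rightarrow> 'a::comm_ring_1"
  assumes i0: "i0 < Suc N" and z: "\<And>i. i < Suc N \<Longrightarrow> i \<noteq> i0 \<Longrightarrow> M i N = 0"
  shows "det (mat (Suc N) (Suc N) (\<lambda>(i,j). M i j)) =
    (-1) ^ (i0 + N) * M i0 N * det (mat N N (\<lambda>(i,j). M (if i < i0 then i else Suc i) j))"
proof -
  let ?A = "mat (Suc N) (Suc N) (\<lambda>(i,j). M i j)"
  have "det ?A = (\<Sum>i<Suc N. ?A $$ (i,N) * cofactor ?A i N)"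
    by (rule laplace_expansion_column) auto
  also have "\<dots> = (\<Sum>i\<in>{i0}. ?A $$ (i,N) * cofactor ?A i N)"
    by (rule sum.mono_neutral_right) (use i0 z in auto)
  also have "\<dots> = M i0 N * ((-1) ^ (i0 + N) * det (mat_delete ?A i0 N))"
    using i0 by (simp add: cofactor_def)
  also have "mat_delete ?A i0 N = mat N N (\<lambda>(i,j). M (if i < i0 then i else Suc i) j)"
    by (intro eq_matI) (auto simp: mat_delete_def)
  finally show ?thesis by (simp add: ac_simps)
qed

text \<open>Bounding the degree row by row, rather than uniformly, is what bounds the degree in a root by the
  number of rows in which that root occurs.\<close>

lemma degree_det_le_sum_rows:
  fixes A :: "'a::comm_ring_1 poly mat"
  assumes A: "A \<in> carrier_mat N N"
    and "\<And>i j. i < N \<Longrightarrow> j < N \<Longrightarrow> degree (A $$ (i,j)) \<le> e i"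
  shows "degree (det A) \<le> (\<Sum>i<N. e i)"
  unfolding det_def'[OF A]
proof (rule degree_sum_le)
  fix p assume "p \<in> {p. p permutes {0..<N}}"
  then have p: "p i < N" if "i < N" for i
    using that permutes_in_image[of p "{0..<N}" i] by auto
  have "degree (signof p * (\<Prod>i = 0..<N. A $$ (i, p i)))
      \<le> degree (signof p :: 'a poly) + degree (\<Prod>i = 0..<N. A $$ (i, p i))"
    by (rule degree_mult_le)
  also have "degree (signof p :: 'a poly) = 0"
    by (simp add: sign_def)
  also have "degree (\<Prod>i = 0..<N. A $$ (i, p i)) \<le> (\<Sum>i = 0..<N. degree (A $$ (i, p i)))"
    using degree_prod_sum_le[of "{0..<N}" "\<lambda>i. A $$ (i, p i)"] by (simp add: o_def)
  also have "\<dots> \<le> (\<Sum>i<N. e i)"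
    unfolding atLeast0LessThan by (intro sum_mono assms(2)) (auto simp: p)
  finally show "degree (signof p * (\<Prod>i = 0..<N. A $$ (i, p i))) \<le> (\<Sum>i<N. e i)" by simp
qed (auto simp: finite_permutations)

text \<open>The rows hold the coefficients of \<open>N\<close> polynomials in the degrees from
  \<open>k + N - 1\<close> down to \<open>k\<close>.\<close>

definition top_coeff_det :: "nat \<Rightarrow> nat \<Rightarrow> (nat \<Rightarrow> 'a::comm_ring_1 poly) \<Rightarrow> 'a" where
  "top_coeff_det N k r = det (mat N N (\<lambda>(i,j). coeff (r i) (k + N - 1 - j)))"

text \<open>For \<open>p\<close> of degree below \<open>k + N\<close>, the top \<open>N\<close> coefficients of
  \<open>h p\<close> depend only on the top \<open>N\<close> coefficients of \<open>p\<close>, through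
  the triangular Toeplitz matrix of \<open>h\<close>, whose diagonal consists of ones because
  \<open>h\<close> is monic.\<close>

lemma top_coeff_det_mult_monic:
  assumes r: "\<And>i. i < N \<Longrightarrow> degree (r i) < k + N" and h: "lead_coeff h = 1"
  shows "top_coeff_det N (k + degree h) (\<lambda>i. h * r i) = top_coeff_det N k r"
  unfolding top_coeff_det_def
proof (rule det_unitriangular_col_ops)
  let ?U = "\<lambda>l j. if l \<le> j \<and> j \<le> degree h + l then coeff h (degree h + l - j) else 0"
  fix i j assume ij: "i < N" "j < N"
  let ?t = "k + degree h + N - 1 - j"
  have "coeff (h * r i) ?t = (\<Sum>u\<le>?t. coeff (r i) u * coeff h (?t - u))"
    by (subst mult.commute) (rule coeff_mult)
  also have "\<dots> = (\<Sum>u\<in>{..?t} \<inter> {k + N - 1 - j..<k + N}. coeff (r i) u * coeff h (?t - u))"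
  proof (rule sum.mono_neutral_right)
    show "\<forall>u\<in>{..?t} - {..?t} \<inter> {k + N - 1 - j..<k + N}. coeff (r i) u * coeff h (?t - u) = 0"
    proof
      fix u assume u: "u \<in> {..?t} - {..?t} \<inter> {k + N - 1 - j..<k + N}"
      then consider "u < k + N - 1 - j" | "u \<ge> k + N" by force
      then show "coeff (r i) u * coeff h (?t - u) = 0"
      proof cases
        case 1
        then have "degree h < ?t - u" using ij by linarith
        then show ?thesis by (simp add: coeff_eq_0)
      next
        case 2
        then have "degree (r i) < u" using r[OF ij(1)] by linarith
        then show ?thesis by (simp add: coeff_eq_0)
      qed
    qed
  qed auto
  also have "\<dots> = (\<Sum>l\<in>{l. l \<le> j \<and> j \<le> degree h + l}. coeff (r i) (k + N - 1 - l) * ?U l j)"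
    by (rule sum.reindex_bij_witness[of _ "\<lambda>l. k + N - 1 - l" "\<lambda>u. k + N - 1 - u"])
       (use ij in \<open>auto intro!: arg_cong2[of _ _ _ _ "(*)"] arg_cong[of _ _ "coeff h"]\<close>)
  also have "\<dots> = (\<Sum>l<N. coeff (r i) (k + N - 1 - l) * ?U l j)"
    by (rule sum.mono_neutral_left) (use ij in auto)
  finally show "coeff (h * r i) ?t = (\<Sum>l<N. coeff (r i) (k + N - 1 - l) * ?U l j)" .
qed (use h in auto)


section \<open>Principal subresultant coefficients\<close>

definition syl_row :: "nat \<Rightarrow> nat \<Rightarrow> 'a::comm_ring_1 poly \<Rightarrow> 'a poly \<Rightarrow> nat \<Rightarrow> 'a poly" where
  "syl_row q p f g i = (if i < q then monom 1 (q - 1 - i) * f else monom 1 (q + p - 1 - i) * g)"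

text \<open>With \<open>p = degree f - k\<close> and \<open>q = degree g - k\<close> this is the principal
  subresultant coefficient of order \<open>k\<close>, and the resultant when \<open>k = 0\<close>.
  The block sizes are parameters so that the value makes sense when \<open>f\<close> and
  \<open>g\<close> are only bounded in degree.\<close>

definition syl_det :: "nat \<Rightarrow> nat \<Rightarrow> nat \<Rightarrow> 'a::comm_ring_1 poly \<Rightarrow> 'a poly \<Rightarrow> 'a" where
  "syl_det k q p f g = top_coeff_det (q + p) k (syl_row q p f g)"

lemma syl_det_swap: "syl_det k q p f g = (-1) ^ (q * p) * syl_det k p q g f"
proof -
  let ?M = "mat (p + q) (p + q) (\<lambda>(i,j). coeff (syl_row p q g f i) (k + (p + q) - 1 - j))"
  have "syl_det k p q g f = det ?M"
    by (simp add: syl_det_def top_coeff_det_def)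
  also have "\<dots> = (-1) ^ (q * p) *
      det (mat (q + p) (q + p) (\<lambda>(i,j). ?M $$ ((if i < q then i + p else i - q), j)))"
    by (rule det_swap_rows) (auto simp: add.commute)
  also have "mat (q + p) (q + p) (\<lambda>(i,j). ?M $$ ((if i < q then i + p else i - q), j)) =
      mat (q + p) (q + p) (\<lambda>(i,j). coeff (syl_row q p f g i) (k + (q + p) - 1 - j))"
    by (intro eq_matI) (auto simp: syl_row_def add.commute)
  finally show ?thesis
    by (simp add: syl_det_def top_coeff_det_def power_mult_distrib[symmetric]
        flip: mult.assoc power_add)
qed

lemma syl_row_mult: "syl_row q p (h * f) (h * g) i = h * syl_row q p f g i"
  by (simp add: syl_row_def ac_simps)

lemma degree_syl_row:
  assumes "degree f \<le> k + p" "degree g \<le> k + q" "i < q + p"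
  shows "degree (syl_row q p f g i) < k + (q + p)"
proof -
  have "degree (monom (1::'a) e * f) \<le> e + degree f" for e and f :: "'a poly"
    by (rule order.trans[OF degree_mult_le]) (simp add: degree_monom_le)
  from this[of "q - 1 - i" f] this[of "q + p - 1 - i" g] show ?thesis
    using assms by (auto simp: syl_row_def)
qed

lemma syl_det_common_factor:
  assumes "lead_coeff h = 1" "degree f \<le> k + p" "degree g \<le> k + q"
  shows "syl_det (k + degree h) q p (h * f) (h * g) = syl_det k q p f g"
  unfolding syl_det_def syl_row_mult
  by (rule top_coeff_det_mult_monic) (use assms degree_syl_row[of f k p g q] in auto)

lemma monom_Suc_diff: "monom 1 (Suc e) * f - smult c (monom 1 e * f) = monom 1 e * ([:- c, 1:] * (f :: 'a::comm_ring_1 poly))"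
  by (simp add: monom_Suc algebra_simps)

text \<open>This is the multiplicativity of the resultant in one linear factor. Chained row operations turn
  all rows but the last into multiples of \<open>y - a\<close>; the last row remains \<open>g\<close>.
  Replacing the last column by the values of the row polynomials at \<open>a\<close> then leaves
  \<open>g(a)\<close> as its only nonzero entry, and the complementary minor consists of multiples of
  \<open>y - a\<close>, a common factor that can be removed.\<close>

lemma syl_det_0_linear_factor:
  fixes f g :: "'a::comm_ring_1 poly"
  assumes f: "degree f \<le> p" and g: "degree g \<le> q"
  shows "syl_det 0 q (Suc p) ([:- a, 1:] * f) g = poly g a * syl_det 0 q p f g"
proof -
  let ?N = "q + p" and ?h = "[:- a, 1:]"
  define r where "r = syl_row q (Suc p) (?h * f) g"
  define S where "S = {q..<q + p}"
  define r' where "r' i = r i - (if i \<in> S then smult a (r (Suc i)) else 0)" for i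
  have r': "r' i = ?h * syl_row q p f g i" if "i < q + p" for i
  proof (cases "i < q")
    case True
    then show ?thesis
      by (simp add: r'_def r_def S_def syl_row_def mult.left_commute del: mult_pCons_left)
  next
    case False
    define e where "e = q + p - 1 - i"
    have "r i = monom 1 (Suc e) * g" "r (Suc i) = monom 1 e * g" "syl_row q p f g i = monom 1 e * g"
      using False that by (simp_all add: r_def syl_row_def e_def Suc_diff_Suc)
    moreover have "i \<in> S" using False that by (simp add: S_def)
    ultimately show ?thesis
      by (simp only: r'_def if_True monom_Suc_diff mult.left_commute)
  qed
  have r'_last: "r' (q + p) = g"
    by (simp add: r'_def r_def S_def syl_row_def)
  have deg: "degree (r i) < Suc ?N" if "i < Suc ?N" for i
    using degree_syl_row[of "?h * f" 0 "Suc p" g q i] f g that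
      degree_mult_le[of ?h f] by (auto simp: r_def)
  have deg': "degree (r' i) < Suc ?N" if "i < Suc ?N" for i
    unfolding r'_def
    by (rule degree_diff_less) (use that deg[of i] deg[of "Suc i"] in \<open>auto simp: S_def intro: le_less_trans[OF degree_smult_le]\<close>)
  have "syl_det 0 q (Suc p) (?h * f) g = det (mat (Suc ?N) (Suc ?N) (\<lambda>(i,j). coeff (r i) (?N - j)))"
    by (simp add: syl_det_def top_coeff_det_def r_def)
  also have "\<dots> = det (mat (Suc ?N) (Suc ?N) (\<lambda>(i,j). coeff (r i) (?N - j) -
      (if i \<in> S then a * coeff (r (Suc i)) (?N - j) else 0)))"
    by (rule det_chained_row_ops[symmetric]) (auto simp: S_def)
  also have "\<dots> = det (mat (Suc ?N) (Suc ?N) (\<lambda>(i,j). coeff (r' i) (?N - j)))"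
    by (intro arg_cong[of _ _ det] eq_matI) (auto simp: r'_def)
  \<comment> \<open>Adding \<open>a ^ (N - l)\<close> times column \<open>l\<close> to the last column evaluates
    the row polynomials at \<open>a\<close>.\<close>
  also have "\<dots> = det (mat (Suc ?N) (Suc ?N)
      (\<lambda>(i,j). if j = ?N then poly (r' i) a else coeff (r' i) (?N - j)))"
  proof (rule det_unitriangular_col_ops[symmetric])
    let ?U = "\<lambda>l j. if j = ?N then a ^ (?N - l) else if l = j then 1 else 0"
    fix i j assume ij: "i < Suc ?N" "j < Suc ?N"
    show "(if j = ?N then poly (r' i) a else coeff (r' i) (?N - j)) =
        (\<Sum>l<Suc ?N. coeff (r' i) (?N - l) * ?U l j)"
    proof (cases "j = ?N")
      case True
      have "poly (r' i) a = (\<Sum>u\<le>?N. coeff (r' i) u * a ^ u)"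
        unfolding poly_altdef using deg'[OF ij(1)]
        by (intro sum.mono_neutral_left) (auto simp: coeff_eq_0)
      also have "\<dots> = (\<Sum>l<Suc ?N. coeff (r' i) (?N - l) * a ^ (?N - l))"
        by (rule sum.reindex_bij_witness[of _ "\<lambda>l. ?N - l" "\<lambda>u. ?N - u"]) auto
      finally show ?thesis using True by simp
    next
      case False
      then have "(\<Sum>l<Suc ?N. coeff (r' i) (?N - l) * ?U l j)
          = (\<Sum>l<Suc ?N. if l = j then coeff (r' i) (?N - l) else 0)"
        by (intro sum.cong) auto
      with False ij show ?thesis by simp
    qed
  qed auto
  also have "\<dots> = (-1) ^ (?N + ?N) * poly g a * det (mat ?N ?N (\<lambda>(i,j). coeff (r' i) (?N - j)))"
    by (subst det_last_col_single[of ?N])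
       (auto simp: r' r'_last intro!: arg_cong2[of _ _ _ _ "(*)"] arg_cong[of _ _ det] eq_matI)
  also have "det (mat ?N ?N (\<lambda>(i,j). coeff (r' i) (?N - j))) = syl_det 1 q p (?h * f) (?h * g)"
    unfolding syl_det_def top_coeff_det_def
    by (intro arg_cong[of _ _ det] eq_matI) (auto simp: r' syl_row_mult simp del: mult_pCons_left)
  also have "\<dots> = syl_det 0 q p f g"
    using syl_det_common_factor[of ?h f 0 p g q] f g by simp
  finally show ?thesis by simp
qed

definition root_poly :: "'a::comm_ring_1 multiset \<Rightarrow> 'a poly" where
  "root_poly A = (\<Prod>a\<in>#A. [:- a, 1:])"

lemma root_poly_simps [simp]:
  "root_poly {#} = 1" "root_poly (add_mset a A) = [:- a, 1:] * root_poly A"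
  "root_poly (A + B) = root_poly A * root_poly B"
  by (simp_all add: root_poly_def)

lemma lead_coeff_root_poly: "lead_coeff (root_poly (A :: 'a::idom multiset)) = 1"
  by (induction A) (simp_all add: lead_coeff_mult del: mult_pCons_left)

lemma root_poly_nonzero: "root_poly (A :: 'a::idom multiset) \<noteq> 0"
  using lead_coeff_root_poly[of A] by auto

lemma degree_root_poly [simp]: "degree (root_poly (A :: 'a::idom multiset)) = size A"
  by (induction A) (simp_all add: degree_mult_eq root_poly_nonzero del: mult_pCons_left)

lemma poly_root_poly: "poly (root_poly A) x = (\<Prod>a\<in>#A. x - a)"
  by (induction A) (simp_all add: algebra_simps)

lemma mset_res_simps [simp]:
  "mset_res {#} Y = 1" "mset_res X {#} = 1"
  "mset_res (add_mset x X) Y = poly (root_poly Y) x * mset_res X Y"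
  "mset_res (X + X') Y = mset_res X Y * mset_res X' Y"
  "mset_res X (Y + Y') = mset_res X Y * mset_res X Y'"
  by (simp_all add: mset_res_def poly_root_poly prod_mset.distrib)

lemma mset_res_commute: "mset_res X Y = (-1) ^ (size X * size Y) * mset_res Y X"
proof (induction X)
  case (add x X)
  have "poly (root_poly Y) x = (-1) ^ size Y * mset_res Y {#x#}"
    by (induction Y) (simp_all add: mset_res_def algebra_simps)
  moreover have "mset_res Y (add_mset x X) = mset_res Y {#x#} * mset_res Y X"
    by (subst add_mset_add_single) (simp only: mset_res_simps mult.commute)
  ultimately show ?case using add by (simp add: power_add)
qed simp

definition psc :: "nat \<Rightarrow> 'a::comm_ring_1 multiset \<Rightarrow> 'a multiset \<Rightarrow> 'a" where
  "psc k A B = syl_det k (size B - k) (size A - k) (root_poly A) (root_poly B)"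

lemma psc_swap: "psc k A B = (-1) ^ ((size A - k) * (size B - k)) * psc k B A"
  unfolding psc_def by (subst syl_det_swap) (simp add: mult.commute)

lemma psc_common_roots:
  fixes A B H :: "'a::idom multiset"
  assumes "k \<le> size A" "k \<le> size B"
  shows "psc (k + size H) (H + A) (H + B) = psc k A B"
  using syl_det_common_factor[of "root_poly H" "root_poly A" k "size A - k" "root_poly B" "size B - k"]
    assms lead_coeff_root_poly[of H] by (simp add: psc_def)

lemma psc_0: "psc 0 A B = mset_res A (B :: 'a::idom multiset)"
proof (induction A)
  case empty
  have "syl_det 0 (size B) 0 1 (root_poly B) =
      det (mat (size B) (size B) (\<lambda>(i,j). if i = j then 1 else 0))"
    unfolding syl_det_def top_coeff_det_def
    by (intro arg_cong[of _ _ det] eq_matI) (auto simp: syl_row_def)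
  also have "\<dots> = 1" by (rule upper_unitriangular_det) auto
  finally show ?case by (simp add: psc_def)
next
  case (add a A)
  then show ?case
    using syl_det_0_linear_factor[of "root_poly A" "size A" "root_poly B" "size B" a]
    by (simp add: psc_def)
qed


section \<open>Symmetric interpolation\<close>

text \<open>\<open>F\<close> is given by a polynomial of degree at most \<open>n\<close>. Over a finite field this
  polynomial is not determined by \<open>F\<close>, therefore only its existence is asserted.\<close>

definition poly_fun :: "nat \<Rightarrow> ('a::comm_ring_1 \<Rightarrow> 'a) \<Rightarrow> bool" where
  "poly_fun n F \<longleftrightarrow> (\<exists>P. degree P \<le> n \<and> (\<forall>x. F x = poly P x))"

lemma poly_fun_poly: "degree P \<le> n \<Longrightarrow> poly_fun n (\<lambda>x. poly P x)"
  by (auto simp: poly_fun_def)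

lemma poly_fun_cmult: "poly_fun n F \<Longrightarrow> poly_fun n (\<lambda>x. c * F x)"
  by (force simp: poly_fun_def intro: order.trans[OF degree_smult_le] exI[of _ "smult c _"])

lemma poly_fun_mono: "poly_fun n F \<Longrightarrow> n \<le> n' \<Longrightarrow> poly_fun n' F"
  by (auto simp: poly_fun_def intro: order.trans)

lemma poly_fun_sum:
  assumes "\<And>i. i \<in> I \<Longrightarrow> poly_fun n (F i)"
  shows "poly_fun n (\<lambda>x. \<Sum>i\<in>I. F i x)"
proof -
  obtain P where P: "\<And>i. i \<in> I \<Longrightarrow> degree (P i) \<le> n" "\<And>i x. i \<in> I \<Longrightarrow> F i x = poly (P i) x"
    using assms unfolding poly_fun_def by metis
  show ?thesis
    unfolding poly_fun_def
  proof (cases "finite I")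
    case True
    then show "\<exists>P. degree P \<le> n \<and> (\<forall>x. (\<Sum>i\<in>I. F i x) = poly P x)"
      by (intro exI[of _ "\<Sum>i\<in>I. P i"]) (auto intro!: degree_sum_le P simp: poly_sum P)
  qed (auto intro: exI[of _ 0])
qed

text \<open>The elements of \<open>Y\<close> are freed one after another. If agreement is known whenever the
  elements outside \<open>Y\<close> are distinct points of \<open>X\<close>, replace one of these points
  by an arbitrary \<open>y\<close>, the others forming a set \<open>D\<close>. Both sides are then
  polynomials in \<open>y\<close> of degree at most \<open>|X| - r\<close>, and they agree at the
  \<open>|X| - |D| \<ge> |X| - r + 1\<close> points of \<open>X - D\<close>.\<close>

lemma symmetric_interpolation:
  fixes F G :: "'a::idom multiset \<Rightarrow> 'a"
  assumes X: "finite X" "r \<le> card X"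
    and F: "\<And>Y. Suc (size Y) = r \<Longrightarrow> poly_fun (card X - r) (\<lambda>y. F (add_mset y Y))"
    and G: "\<And>Y. Suc (size Y) = r \<Longrightarrow> poly_fun (card X - r) (\<lambda>y. G (add_mset y Y))"
    and eq: "\<And>D. D \<subseteq> X \<Longrightarrow> card D = r \<Longrightarrow> F (mset_set D) = G (mset_set D)"
    and Y: "size Y = r"
  shows "F Y = G Y"
proof -
  have "F (Y + mset_set D) = G (Y + mset_set D)" if "D \<subseteq> X" "size Y + card D = r" for D
    using that
  proof (induction Y arbitrary: D)
    case empty
    then show ?case using eq by simp
  next
    case (add y Y)
    have fin: "finite D" using add.prems X(1) finite_subset by auto
    let ?Z = "Y + mset_set D"
    have sz: "Suc (size ?Z) = r" using add.prems fin by simp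
    obtain P where P: "degree P \<le> card X - r" "\<And>y. F (add_mset y ?Z) = poly P y"
      using F[OF sz] by (auto simp: poly_fun_def)
    obtain Q where Q: "degree Q \<le> card X - r" "\<And>y. G (add_mset y ?Z) = poly Q y"
      using G[OF sz] by (auto simp: poly_fun_def)
    have "P = Q"
    proof (rule poly_eqI_degree[of "X - D"])
      fix z assume z: "z \<in> X - D"
      then have "F (Y + mset_set (insert z D)) = G (Y + mset_set (insert z D))"
        using add.prems fin by (intro add.IH) auto
      then show "poly P z = poly Q z" using z fin P(2)[of z] Q(2)[of z] by simp
    next
      have "card (X - D) = card X - card D"
        using add.prems fin by (intro card_Diff_subset) auto
      then have "card X - r < card (X - D)" using add.prems X by simp
      then show "degree P < card (X - D)" "degree Q < card (X - D)" using P Q by auto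
    qed
    then show ?case using P(2)[of y] Q(2)[of y] by simp
  qed
  from this[of "{}"] Y show ?thesis by simp
qed

text \<open>A root of the first factor enters linearly into each of the \<open>q\<close> rows that come from
  it, and into no other row.\<close>

lemma poly_fun_syl_det:
  fixes f g :: "'a::comm_ring_1 poly"
  shows "poly_fun q (\<lambda>a. syl_det k q p ([:- a, 1:] * f) g)"
proof -
  let ?N = "q + p"
  let ?e = "\<lambda>j. k + ?N - 1 - j"
  define M where "M = mat ?N ?N (\<lambda>(i,j).
    if i < q then [: coeff (pCons 0 (syl_row q p f g i)) (?e j), - coeff (syl_row q p f g i) (?e j) :]
    else [: coeff (syl_row q p f g i) (?e j) :])"
  have "degree (det M) \<le> (\<Sum>i<?N. if i < q then 1 else 0)"
    by (rule degree_det_le_sum_rows) (auto simp: M_def)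
  also have "\<dots> = q" by (simp add: sum.If_cases Int_absorb1 subset_eq flip: lessThan_def)
  finally have "degree (det M) \<le> q" .
  moreover have "syl_det k q p ([:- a, 1:] * f) g = poly (det M) a" for a
  proof -
    interpret comm_ring_hom "\<lambda>P. poly P a" by unfold_locales auto
    have "syl_row q p ([:- a, 1:] * f) g i = [:- a, 1:] * syl_row q p f g i" if "i < q" for i
      using that by (simp add: syl_row_def mult.left_commute del: mult_pCons_left)
    moreover have "syl_row q p ([:- a, 1:] * f) g i = syl_row q p f g i" if "\<not> i < q" for i
      using that by (simp add: syl_row_def)
    moreover have "coeff ([:- a, 1:] * r) e = coeff (pCons 0 r) e - a * coeff r e" for e r
      by simp
    ultimately show ?thesis
      unfolding hom_det[symmetric] syl_det_def top_coeff_det_def M_def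
      by (intro arg_cong[of _ _ det] eq_matI) (auto simp del: mult_pCons_left)
  qed
  ultimately show ?thesis by (auto simp: poly_fun_def)
qed

lemma poly_fun_psc_left: "poly_fun (size B - k) (\<lambda>a. psc k (add_mset a A) B)"
  unfolding psc_def using poly_fun_syl_det by simp

lemma poly_fun_psc_right: "poly_fun (size A - k) (\<lambda>b. psc k A (add_mset b B))"
  by (subst psc_swap) (auto intro: poly_fun_cmult poly_fun_psc_left)

lemma poly_fun_mset_res_left: "poly_fun (size Y) (\<lambda>x. mset_res (add_mset x X) (Y :: 'a::idom multiset))"
  using poly_fun_cmult[OF poly_fun_poly[of "root_poly Y"], of "size Y" "mset_res X Y"]
  by (simp add: mult.commute)

lemma poly_fun_mset_res_right: "poly_fun (size X) (\<lambda>y. mset_res X (add_mset y (Y :: 'a::idom multiset)))"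
  by (subst mset_res_commute, unfold size_add_mset)
     (intro poly_fun_cmult poly_fun_mset_res_left)

section \<open>Sums over subsets of roots\<close>

lemma mset_res_eq_0:
  assumes "x \<in># X" "x \<in># Y"
  shows "mset_res X Y = 0"
proof -
  obtain X' Y' where "X = add_mset x X'" "Y = add_mset x Y'"
    using assms by (metis insert_DiffM)
  then show ?thesis by simp
qed

lemma mset_res_nonzero: "set_mset X \<inter> set_mset Y = {} \<Longrightarrow> mset_res X (Y :: 'a::idom multiset) \<noteq> 0"
  by (auto simp: mset_res_def prod_mset_zero_iff disjoint_iff)

lemma mset_res_sets_nonzero:
  "finite X \<Longrightarrow> D \<subseteq> X \<Longrightarrow> mset_res (mset_set D) (mset_set (X - D) :: 'a::idom multiset) \<noteq> 0"
  by (rule mset_res_nonzero) (auto simp: finite_subset)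

lemma mset_set_Diff_plus: "finite X \<Longrightarrow> D \<subseteq> X \<Longrightarrow> mset_set D + mset_set (X - D) = mset_set X"
  by (subst mset_set_Union[symmetric]) (auto simp: finite_subset Un_absorb1)

text \<open>At an interpolation node the summand vanishes for every subset that misses some point of
  \<open>D\<close>, and \<open>D\<close> itself is the only subset of its size that misses none.\<close>

lemma sum_over_subsets_single:
  assumes "finite X" "D \<subseteq> X" "card D = r"
    and "\<And>E x. E \<subseteq> X \<Longrightarrow> card E = r \<Longrightarrow> x \<in> D \<Longrightarrow> x \<in> X - E \<Longrightarrow> h E = 0"
  shows "(\<Sum>E | E \<subseteq> X \<and> card E = r. h E) = (h D :: 'b::comm_monoid_add)"
proof -
  have "(\<Sum>E | E \<subseteq> X \<and> card E = r. h E) = (\<Sum>E\<in>{D}. h E)"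
  proof (rule sum.mono_neutral_right)
    show "\<forall>E\<in>{E. E \<subseteq> X \<and> card E = r} - {D}. h E = 0"
    proof
      fix E assume E: "E \<in> {E. E \<subseteq> X \<and> card E = r} - {D}"
      then have "finite E" using assms(1) finite_subset by auto
      then have "\<not> D \<subseteq> E" using E assms(3) card_subset_eq[of E D] by auto
      then show "h E = 0" using E assms(2,4) by blast
    qed
  qed (use assms in auto)
  then show ?thesis by simp
qed

text \<open>Interpolation in \<open>k\<close> of the elements of \<open>A\<close> at the nodes \<open>B\<close>:
  at a \<open>k\<close>-subset \<open>D\<close> of \<open>B\<close>, the left-hand side reduces to a
  resultant, and the sum to its term for \<open>D\<close>.\<close>

lemma psc_single_sum:
  fixes A :: "'a::field multiset"
  assumes "finite B" "k \<le> size A" "k \<le> card B"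
  shows "psc k A (mset_set B) = (\<Sum>D | D \<subseteq> B \<and> card D = k.
    mset_res A (mset_set (B - D)) / mset_res (mset_set D) (mset_set (B - D)))"
proof -
  obtain xs where xs: "A = mset xs" by (metis ex_mset)
  define Y A1 where "Y = mset (take k xs)" and "A1 = mset (drop k xs)"
  have A: "A = Y + A1" by (simp add: Y_def A1_def xs flip: mset_append)
  have Y: "size Y = k" using assms(2) by (simp add: Y_def xs)
  let ?t = "\<lambda>Z D. mset_res (Z + A1) (mset_set (B - D)) / mset_res (mset_set D) (mset_set (B - D))"
  have sizes: "card (B - D) = card B - card D" if "D \<subseteq> B" for D
    using that assms(1) by (simp add: card_Diff_subset finite_subset)
  have "psc k (Y + A1) (mset_set B) = (\<Sum>D | D \<subseteq> B \<and> card D = k. ?t Y D)"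
  proof (rule symmetric_interpolation[OF assms(1,3) _ _ _ Y])
    fix Z :: "'a multiset"
    show "poly_fun (card B - k) (\<lambda>y. psc k (add_mset y Z + A1) (mset_set B))"
      using poly_fun_psc_left[of "mset_set B" k "Z + A1"] by simp
    show "poly_fun (card B - k) (\<lambda>y. \<Sum>D | D \<subseteq> B \<and> card D = k. ?t (add_mset y Z) D)"
    proof (rule poly_fun_sum)
      fix D assume "D \<in> {D. D \<subseteq> B \<and> card D = k}"
      then show "poly_fun (card B - k) (\<lambda>y. ?t (add_mset y Z) D)"
        using poly_fun_cmult[OF poly_fun_mset_res_left[of "mset_set (B - D)" "Z + A1"],
            of "inverse (mset_res (mset_set D) (mset_set (B - D)))"] sizes[of D]
        by (simp add: field_simps)
    qed
  next
    fix D assume D: "D \<subseteq> B" "card D = k"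
    have "psc k (mset_set D + A1) (mset_set B) = psc (0 + size (mset_set D)) (mset_set D + A1) (mset_set D + mset_set (B - D))"
      using D assms(1) by (simp add: mset_set_Diff_plus)
    also have "\<dots> = mset_res A1 (mset_set (B - D))"
      by (subst psc_common_roots) (simp_all add: psc_0)
    also have "\<dots> = ?t (mset_set D) D"
      using mset_res_sets_nonzero[OF assms(1) D(1)] by simp
    also have "\<dots> = (\<Sum>D' | D' \<subseteq> B \<and> card D' = k. ?t (mset_set D) D')"
    proof (rule sum_over_subsets_single[symmetric, OF assms(1) D])
      fix E x assume "E \<subseteq> B" "x \<in> D" "x \<in> B - E"
      then have "mset_res (mset_set D) (mset_set (B - E)) = 0"
        using D assms(1) by (intro mset_res_eq_0[of x]) (auto simp: finite_subset)
      then show "?t (mset_set D) E = 0" by simp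
    qed
    finally show "psc k (mset_set D + A1) (mset_set B) = (\<Sum>D' | D' \<subseteq> B \<and> card D' = k. ?t (mset_set D) D')" .
  qed
  then show ?thesis using A by simp
qed

text \<open>Interpolation in the elements of \<open>B0\<close> at the nodes \<open>Ab\<close>. In such an element
  the left-hand side has degree at most \<open>|A0| + |Ab| - k\<close>, which the first assumption on
  \<open>k\<close> bounds by the admissible \<open>|Ab| - |B0|\<close>. At a subset \<open>D\<close> of
  \<open>Ab\<close> the roots \<open>D\<close> are common; the term of the outer sum for
  \<open>D\<close> is the single sum for what remains, up to the quotient of
  \<open>mset_res (Ab - D) D\<close> and \<open>mset_res D (Ab - D)\<close>, which is the sign.\<close>

lemma psc_double_sum:
  fixes A0 B0 :: "'a::field multiset"
  assumes fin: "finite Ab" "finite Bb"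
    and k: "size A0 + size B0 \<le> k" "k \<le> size A0 + card Ab" "k \<le> size B0 + card Bb"
  shows "psc k (A0 + mset_set Ab) (B0 + mset_set Bb) =
    (-1) ^ (size B0 * (card Ab - size B0)) *
    (\<Sum>A' | A' \<subseteq> Ab \<and> card A' = size B0. \<Sum>B' | B' \<subseteq> Bb \<and> card B' = k - size B0.
      mset_res A0 (mset_set (Bb - B')) * mset_res (mset_set (Ab - A')) (B0 + mset_set (Bb - B')) /
      (mset_res (mset_set A') (mset_set (Ab - A')) * mset_res (mset_set B') (mset_set (Bb - B'))))"
proof -
  define r where "r = size B0"
  let ?A = "A0 + mset_set Ab"
  let ?t = "\<lambda>Y A' B'. mset_res A0 (mset_set (Bb - B')) * mset_res (mset_set (Ab - A')) (Y + mset_set (Bb - B')) /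
      (mset_res (mset_set A') (mset_set (Ab - A')) * mset_res (mset_set B') (mset_set (Bb - B')))"
  let ?S = "\<lambda>Y. \<Sum>A' | A' \<subseteq> Ab \<and> card A' = r. \<Sum>B' | B' \<subseteq> Bb \<and> card B' = k - r. ?t Y A' B'"
  have r: "r \<le> card Ab" "r \<le> k" using k by (auto simp: r_def)
  have sizes: "card (Ab - A') = card Ab - card A'" if "A' \<subseteq> Ab" for A'
    using that fin by (simp add: card_Diff_subset finite_subset)
  have "psc k ?A (B0 + mset_set Bb) = (-1) ^ (r * (card Ab - r)) * ?S B0"
  proof (rule symmetric_interpolation[OF fin(1) r(1)])
    fix Z :: "'a multiset"
    show "poly_fun (card Ab - r) (\<lambda>y. psc k ?A (add_mset y Z + mset_set Bb))"
      using poly_fun_mono[OF poly_fun_psc_right[of ?A k "Z + mset_set Bb"], of "card Ab - r"] k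
      by (simp add: r_def)
    have "poly_fun (card Ab - r) (\<lambda>y. ?t (add_mset y Z) A' B')" if "A' \<subseteq> Ab" "card A' = r" for A' B'
      using poly_fun_cmult[OF poly_fun_mset_res_right[of "mset_set (Ab - A')" "Z + mset_set (Bb - B')"],
          of "mset_res A0 (mset_set (Bb - B')) / (mset_res (mset_set A') (mset_set (Ab - A')) *
            mset_res (mset_set B') (mset_set (Bb - B')))"] that sizes[of A']
      by (simp del: mset_res_simps)
    then show "poly_fun (card Ab - r) (\<lambda>y. (-1) ^ (r * (card Ab - r)) * ?S (add_mset y Z))"
      by (intro poly_fun_cmult poly_fun_sum) auto
  next
    fix D assume D: "D \<subseteq> Ab" "card D = r"
    let ?A1 = "A0 + mset_set (Ab - D)"
    let ?u = "\<lambda>B'. mset_res ?A1 (mset_set (Bb - B')) / mset_res (mset_set B') (mset_set (Bb - B'))"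
    have sz: "size (mset_set D) = r" using D by simp
    have "?A = mset_set D + ?A1"
      using mset_set_Diff_plus[OF fin(1) D(1)] by (simp add: ac_simps)
    then have "psc k ?A (mset_set D + mset_set Bb) =
        psc (k - r + size (mset_set D)) (mset_set D + ?A1) (mset_set D + mset_set Bb)"
      using r sz by (simp only: le_add_diff_inverse2)
    also have "\<dots> = psc (k - r) ?A1 (mset_set Bb)"
      using k D fin sizes[of D] by (intro psc_common_roots) (auto simp: r_def)
    also have "\<dots> = (\<Sum>B' | B' \<subseteq> Bb \<and> card B' = k - r. ?u B')"
      using k D fin sizes[of D] by (intro psc_single_sum) (auto simp: r_def)
    also have "\<dots> = (\<Sum>B' | B' \<subseteq> Bb \<and> card B' = k - r. (-1) ^ (r * (card Ab - r)) * ?t (mset_set D) D B')"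
    proof (rule sum.cong[OF refl])
      fix B'
      have "mset_res (mset_set (Ab - D)) (mset_set D) =
          (-1) ^ (r * (card Ab - r)) * mset_res (mset_set D) (mset_set (Ab - D))"
        using D sizes[of D] by (subst mset_res_commute) (simp add: mult.commute)
      then show "?u B' = (-1) ^ (r * (card Ab - r)) * ?t (mset_set D) D B'"
        using mset_res_sets_nonzero[OF fin(1) D(1)] by (simp flip: power_mult_distrib)
    qed
    also have "\<dots> = (-1) ^ (r * (card Ab - r)) * (\<Sum>B' | B' \<subseteq> Bb \<and> card B' = k - r. ?t (mset_set D) D B')"
      by (simp add: sum_distrib_left)
    also have "(\<Sum>B' | B' \<subseteq> Bb \<and> card B' = k - r. ?t (mset_set D) D B') = ?S (mset_set D)"
    proof (rule sum_over_subsets_single[symmetric, OF fin(1) D])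
      fix E x assume "E \<subseteq> Ab" "x \<in> D" "x \<in> Ab - E"
      then have "mset_res (mset_set (Ab - E)) (mset_set D) = 0"
        using D fin by (intro mset_res_eq_0[of x]) (auto simp: finite_subset)
      then show "(\<Sum>B' | B' \<subseteq> Bb \<and> card B' = k - r. ?t (mset_set D) E B') = 0" by simp
    qed
    finally show "psc k ?A (mset_set D + mset_set Bb) = (-1) ^ (r * (card Ab - r)) * ?S (mset_set D)" .
  qed (simp add: r_def)
  then show ?thesis by (simp only: r_def)
qed


section \<open>The cofactors as principal subresultant coefficients\<close>

text \<open>Apart from its last column, the matrix of the cofactors holds the coefficients of the Sylvester
  rows in the degrees above \<open>d\<close>.\<close>

lemma subres_mat_entry:
  assumes "d < degree f" "d < degree g"
    and "i < degree g - d + (degree f - d)" "j < degree g - d + (degree f - d)"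
  shows "subres_mat d f g c $$ (i,j) =
    (if j = degree g - d + (degree f - d) - 1 then c i
     else [:coeff (syl_row (degree g - d) (degree f - d) f g i)
       (d + (degree g - d + (degree f - d)) - 1 - j):])"
proof -
  obtain q p where q: "degree g = d + q" and p: "degree f = d + p"
    using assms(1,2) less_imp_add_positive by metis
  show ?thesis
  proof (cases "j = q + p - 1")
    case True
    then show ?thesis using assms unfolding subres_mat_def Let_def q p by (simp add: add.commute)
  next
    case False
    then have j: "j < q + p - 1" "i < q + p" using assms by (simp_all add: q p)
    have "subres_mat d f g c $$ (i,j) =
        (if i < q then (if j \<le> d + p + i then [:coeff f (d + p + i - j):] else 0)
         else (if j \<le> d + q + (i - q) then [:coeff g (d + q + (i - q) - j):] else 0))"
      using False j unfolding subres_mat_def Let_def q p by (simp add: add.commute)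
    also have "\<dots> = [:coeff (syl_row q p f g i) (d + (q + p) - 1 - j):]"
    proof (cases "i < q")
      case True
      have "d + (q + p) - 1 - j - (q - 1 - i) = d + p + i - j"
        "d + (q + p) - 1 - j < q - 1 - i \<longleftrightarrow> \<not> j \<le> d + p + i"
        using True j by auto
      then show ?thesis using True by (simp add: syl_row_def coeff_monom_mult)
    next
      case False
      then obtain l where l: "i = q + l" by (metis le_add_diff_inverse not_less)
      have "d + (q + p) - 1 - j - (q + p - 1 - i) = d + q + l - j"
        "d + (q + p) - 1 - j < q + p - 1 - i \<longleftrightarrow> \<not> j \<le> d + q + l"
        using l j by auto
      then show ?thesis by (simp add: syl_row_def coeff_monom_mult l)
    qed
    finally show ?thesis using False by (simp add: q p)
  qed
qed

lemma subres_mat_carrier: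
  assumes "d < degree f" "d < degree g"
  shows "subres_mat d f g c \<in> carrier_mat (degree g - d + (degree f - d)) (degree g - d + (degree f - d))"
  using assms by (auto simp: subres_mat_def Let_def)

lemma degree_det_subres_mat:
  fixes f g :: "'a::comm_ring_1 poly"
  assumes d: "d < degree f" "d < degree g" and c: "\<And>i. degree (c i) \<le> e"
  shows "degree (det (subres_mat d f g c)) \<le> e"
proof -
  let ?N = "degree g - d + (degree f - d)"
  let ?T = "(subres_mat d f g c)\<^sup>T"
  have T: "?T \<in> carrier_mat ?N ?N" using subres_mat_carrier[OF d, of c] by simp
  have "degree (det ?T) \<le> (\<Sum>j<?N. if j = ?N - 1 then e else 0)"
    by (rule degree_det_le_sum_rows[OF T])
       (use subres_mat_carrier[OF d, of c] in \<open>auto simp: subres_mat_entry[OF d] c\<close>)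
  also have "\<dots> = e" using d by simp
  finally show ?thesis using det_transpose[OF subres_mat_carrier[OF d, of c]] by simp
qed

text \<open>The step common to both cofactors. The chained operations on the rows in \<open>S\<close> reduce the
  last column to a single 1 in row \<open>i0\<close>; expanding along it removes that row, and
  \<open>r'\<close> lists the polynomials in the rows that remain.\<close>

lemma poly_det_subres_mat:
  fixes f g :: "'a::comm_ring_1 poly"
  assumes d: "d < degree f" "d < degree g"
    and N: "Suc N = degree g - d + (degree f - d)"
    and S: "\<And>i. i \<in> S \<Longrightarrow> i < N"
    and i0: "i0 < Suc N"
    and c: "\<And>i. i < Suc N \<Longrightarrow>
      poly (c i) x - (if i \<in> S then x * poly (c (Suc i)) x else 0) = (if i = i0 then 1 else 0)"
    and r: "\<And>i. r i = syl_row (degree g - d) (degree f - d) f g i"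
    and r': "\<And>i. i < N \<Longrightarrow> (let l = (if i < i0 then i else Suc i) in
      r l - (if l \<in> S then smult x (r (Suc l)) else 0)) = r' i"
  shows "poly (det (subres_mat d f g c)) x = (-1) ^ (i0 + N) * top_coeff_det N (d + 1) r'"
proof -
  interpret comm_ring_hom "\<lambda>P. poly P x" by unfold_locales auto
  define M where "M i j = (if j = N then poly (c i) x else coeff (r i) (d + N - j))" for i j
  let ?M' = "\<lambda>i j. M i j - (if i \<in> S then x * M (Suc i) j else 0)"
  have "poly (det (subres_mat d f g c)) x = det (mat (Suc N) (Suc N) (\<lambda>(i,j). M i j))"
    unfolding hom_det[symmetric]
  proof (intro arg_cong[of _ _ det] eq_matI)
    fix i j assume "i < dim_row (mat (Suc N) (Suc N) (\<lambda>(i,j). M i j))"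
      "j < dim_col (mat (Suc N) (Suc N) (\<lambda>(i,j). M i j))"
    then have ij: "i < Suc N" "j < Suc N" by auto
    then show "map_mat (\<lambda>P. poly P x) (subres_mat d f g c) $$ (i, j) =
        mat (Suc N) (Suc N) (\<lambda>(i,j). M i j) $$ (i, j)"
      using subres_mat_carrier[OF d, of c] subres_mat_entry[OF d, of i j c]
      by (simp add: N[symmetric] M_def r)
  qed (use subres_mat_carrier[OF d, of c] in \<open>auto simp: N[symmetric]\<close>)
  also have "\<dots> = det (mat (Suc N) (Suc N) (\<lambda>(i,j). ?M' i j))"
    by (rule det_chained_row_ops[symmetric]) (use S in auto)
  also have "\<dots> = (-1) ^ (i0 + N) * ?M' i0 N * det (mat N N (\<lambda>(i,j). ?M' (if i < i0 then i else Suc i) j))"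
  proof (rule det_last_col_single[OF i0])
    fix i assume "i < Suc N" "i \<noteq> i0"
    then show "?M' i N = 0" using c[of i] by (simp add: M_def)
  qed
  also have "?M' i0 N = 1" using c[OF i0] by (auto simp: M_def split: if_splits)
  also have "det (mat N N (\<lambda>(i,j). ?M' (if i < i0 then i else Suc i) j)) = top_coeff_det N (d + 1) r'"
    unfolding top_coeff_det_def
  proof (intro arg_cong[of _ _ det] eq_matI; clarsimp)
    fix i j assume "i < N" "j < N"
    then show "(i < i0 \<longrightarrow> (i \<in> S \<longrightarrow> M i j - x * M (Suc i) j = coeff (r' i) (d + N - j)) \<and>
          (i \<notin> S \<longrightarrow> M i j = coeff (r' i) (d + N - j))) \<and>
        (\<not> i < i0 \<longrightarrow> (Suc i \<in> S \<longrightarrow> M (Suc i) j - x * M (Suc (Suc i)) j = coeff (r' i) (d + N - j)) \<and>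
          (Suc i \<notin> S \<longrightarrow> M (Suc i) j = coeff (r' i) (d + N - j)))"
      by (auto simp: M_def Let_def simp flip: r')
  qed
  finally show ?thesis by simp
qed

lemma poly_F_cof:
  fixes f g :: "'a::comm_ring_1 poly"
  assumes d: "d < degree f" "d < degree g"
  shows "poly (F_cof d f g) x = (-1) ^ (degree f - d) *
    syl_det (d + 1) (degree g - d - 1) (degree f - d) ([:- x, 1:] * f) g"
proof -
  define q p where "q = degree g - d - 1" and "p = degree f - d"
  have q: "degree g - d = Suc q" and p: "degree f - d = p" and "p > 0"
    using d by (auto simp: q_def p_def)
  have "poly (F_cof d f g) x = (-1) ^ (q + (q + p)) *
      top_coeff_det (q + p) (d + 1) (syl_row q p ([:- x, 1:] * f) g)"
    unfolding F_cof_def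
  proof (rule poly_det_subres_mat[OF d, where S = "{..<q}"])
    fix i assume "i < Suc (q + p)"
    show "poly (if i < degree g - d then monom 1 (degree g - d - 1 - i) else 0) x -
        (if i \<in> {..<q} then x * poly (if Suc i < degree g - d then monom 1 (degree g - d - 1 - Suc i) else 0) x else 0) =
        (if i = q then 1 else 0)"
      by (auto simp: q poly_monom Suc_diff_Suc simp flip: power_Suc)
  next
    fix i assume i: "i < q + p"
    let ?r = "syl_row (degree g - d) (degree f - d) f g"
    show "(let l = if i < q then i else Suc i in ?r l - (if l \<in> {..<q} then smult x (?r (Suc l)) else 0)) =
        syl_row q p ([:- x, 1:] * f) g i"
    proof (cases "i < q")
      case True
      define e where "e = q - 1 - i"
      have "?r i = monom 1 (Suc e) * f" "?r (Suc i) = monom 1 e * f"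
        "syl_row q p ([:- x, 1:] * f) g i = monom 1 e * ([:- x, 1:] * f)"
        using True by (simp_all add: syl_row_def q p e_def Suc_diff_Suc del: mult_pCons_left)
      then show ?thesis using True by (simp add: monom_Suc_diff del: mult_pCons_left)
    next
      case False
      then show ?thesis using i by (simp add: syl_row_def q p)
    qed
  qed (use \<open>p > 0\<close> in \<open>auto simp: q p\<close>)
  then show ?thesis
    by (simp add: syl_det_def q p power_add flip: power_mult_distrib)
qed

lemma poly_G_cof:
  fixes f g :: "'a::comm_ring_1 poly"
  assumes d: "d < degree f" "d < degree g"
  shows "poly (G_cof d f g) x =
    syl_det (d + 1) (degree g - d) (degree f - d - 1) f ([:- x, 1:] * g)"
proof -
  define q p where "q = degree g - d" and "p = degree f - d - 1"
  have q: "degree g - d = q" and p: "degree f - d = Suc p" and "q > 0"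
    using d by (auto simp: q_def p_def)
  have "poly (G_cof d f g) x = (-1) ^ (q + p + (q + p)) *
      top_coeff_det (q + p) (d + 1) (syl_row q p f ([:- x, 1:] * g))"
    unfolding G_cof_def
  proof (rule poly_det_subres_mat[OF d, where S = "{q..<q + p}"])
    fix i assume "i < Suc (q + p)"
    show "poly (if i < degree g - d then 0 else monom 1 (degree f - d - 1 - (i - (degree g - d)))) x -
        (if i \<in> {q..<q + p} then x * poly (if Suc i < degree g - d then 0
          else monom 1 (degree f - d - 1 - (Suc i - (degree g - d)))) x else 0) =
        (if i = q + p then 1 else 0)"
      using \<open>i < Suc (q + p)\<close> by (auto simp: q p poly_monom Suc_diff_Suc Suc_diff_le simp flip: power_Suc)
  next
    fix i assume i: "i < q + p"
    let ?r = "syl_row (degree g - d) (degree f - d) f g"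
    show "(let l = if i < q + p then i else Suc i in
        ?r l - (if l \<in> {q..<q + p} then smult x (?r (Suc l)) else 0)) =
        syl_row q p f ([:- x, 1:] * g) i"
    proof (cases "i < q")
      case False
      define e where "e = q + p - 1 - i"
      have "?r i = monom 1 (Suc e) * g" "?r (Suc i) = monom 1 e * g"
        "syl_row q p f ([:- x, 1:] * g) i = monom 1 e * ([:- x, 1:] * g)"
        using False i by (simp_all add: syl_row_def q p e_def Suc_diff_Suc del: mult_pCons_left)
      then show ?thesis using False i by (simp add: monom_Suc_diff del: mult_pCons_left)
    next
      case True
      then show ?thesis using i by (simp add: syl_row_def q p)
    qed
  qed (use \<open>q > 0\<close> in \<open>auto simp: q p\<close>)
  then show ?thesis
    by (simp add: syl_det_def q p flip: power_mult_distrib)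
qed

lemma degree_F_cof:
  assumes "d < degree f" "d < degree g"
  shows "degree (F_cof d f g) \<le> degree g - d - 1"
  unfolding F_cof_def by (rule degree_det_subres_mat[OF assms]) (auto intro: order.trans[OF degree_monom_le])

lemma degree_G_cof:
  assumes "d < degree f" "d < degree g"
  shows "degree (G_cof d f g) \<le> degree f - d - 1"
  unfolding G_cof_def by (rule degree_det_subres_mat[OF assms]) (auto intro: order.trans[OF degree_monom_le])


lemma mset_res_var_eq_root_poly: "mset_res_var Y = root_poly Y"
  by (simp add: mset_res_var_def mset_res_def root_poly_def image_mset.compositionality o_def)

lemma degree_signed_double_sum:
  fixes h :: "'b \<Rightarrow> 'c \<Rightarrow> 'a::comm_ring_1 poly"
  assumes "\<And>i j. i \<in> I \<Longrightarrow> j \<in> J \<Longrightarrow> degree (h i j) \<le> e"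
  shows "degree ((-1) ^ l * (\<Sum>i\<in>I. \<Sum>j\<in>J. h i j)) \<le> e"
proof -
  have sum: "degree (\<Sum>i\<in>I. \<Sum>j\<in>J. h i j) \<le> e"
  proof (cases "finite I \<and> finite J")
    case True
    then show ?thesis by (intro degree_sum_le assms) auto
  qed (auto simp: sum.infinite)
  show ?thesis
    using minus_one_power_iff[of l, where ?'a = "'a poly"] sum by (auto split: if_splits)
qed

text \<open>The double sum with \<open>k = d + 1\<close>, where \<open>x\<close> joins the multiset
  \<open>A0\<close> and contributes the factor \<open>root_poly (Bb - B')\<close> evaluated at
  \<open>x\<close>.\<close>

lemma F_cof_double_sum:
  fixes A0 B0 :: "'a::field multiset"
  assumes fin: "finite Ab" "finite Bb"
    and d: "size A0 + size B0 \<le> d" "d < size A0 + card Ab" "d < size B0 + card Bb"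
  shows "F_cof d (root_poly (A0 + mset_set Ab)) (root_poly (B0 + mset_set Bb)) =
    (-1) ^ (size A0 + card Ab - d + size B0 * (card Ab - 1)) *
    (\<Sum>A' | A' \<subseteq> Ab \<and> card A' = size B0. \<Sum>B' | B' \<subseteq> Bb \<and> card B' = d + 1 - size B0.
      smult (mset_res A0 (mset_set (Bb - B')) * mset_res (mset_set (Ab - A')) (B0 + mset_set (Bb - B')) /
        (mset_res (mset_set A') (mset_set (Ab - A')) * mset_res (mset_set B') (mset_set (Bb - B'))))
      (root_poly (mset_set (Bb - B'))))"
    (is "?F = ?R")
proof (rule poly_eqI_degree[of Bb])
  let ?f = "root_poly (A0 + mset_set Ab)" and ?g = "root_poly (B0 + mset_set Bb)"
  have deg: "degree ?f = size A0 + card Ab" "degree ?g = size B0 + card Bb"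
    by (simp_all only: degree_root_poly size_union size_mset_set)
  have d': "d < degree ?f" "d < degree ?g" using d deg by simp_all
  have "degree ?F \<le> degree ?g - d - 1"
    by (rule degree_F_cof[OF d'])
  then show "degree ?F < card Bb"
    using d deg by linarith
  have "degree ?R \<le> size B0 + card Bb - d - 1"
  proof (rule degree_signed_double_sum, rule order.trans[OF degree_smult_le])
    fix B' assume "B' \<in> {B'. B' \<subseteq> Bb \<and> card B' = d + 1 - size B0}"
    then show "degree (root_poly (mset_set (Bb - B'))) \<le> size B0 + card Bb - d - 1"
      using fin d by (auto simp: card_Diff_subset finite_subset)
  qed
  then show "degree ?R < card Bb"
    using d by linarith
next
  fix x
  let ?f = "root_poly (A0 + mset_set Ab)" and ?g = "root_poly (B0 + mset_set Bb)"
  let ?k = "d + 1"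
  have deg: "degree ?f = size A0 + card Ab" "degree ?g = size B0 + card Bb"
    by (simp_all only: degree_root_poly size_union size_mset_set)
  have d': "d < degree ?f" "d < degree ?g" using d deg by simp_all
  \<comment> \<open>The exponents differ by \<open>|B0| (|B0| - 1)\<close>, which is even.\<close>
  have sign: "(-1) ^ (size B0 * (card Ab - size B0)) = ((-1) ^ (size B0 * (card Ab - 1)) :: 'a)"
    using d by (auto simp: minus_one_power_iff)
  have "poly ?F x = (-1) ^ (size A0 + card Ab - d) * psc ?k (add_mset x A0 + mset_set Ab) (B0 + mset_set Bb)"
    unfolding poly_F_cof[OF d'] deg using d by (simp add: psc_def)
  also have "psc ?k (add_mset x A0 + mset_set Ab) (B0 + mset_set Bb) =
    (-1) ^ (size B0 * (card Ab - 1)) *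
    (\<Sum>A' | A' \<subseteq> Ab \<and> card A' = size B0. \<Sum>B' | B' \<subseteq> Bb \<and> card B' = ?k - size B0.
      mset_res (add_mset x A0) (mset_set (Bb - B')) * mset_res (mset_set (Ab - A')) (B0 + mset_set (Bb - B')) /
      (mset_res (mset_set A') (mset_set (Ab - A')) * mset_res (mset_set B') (mset_set (Bb - B'))))"
    using d by (subst psc_double_sum[OF fin]) (auto simp: sign)
  finally show "poly ?F x = poly ?R x"
    by (simp add: poly_sum power_add ac_simps)
qed

text \<open>Here \<open>x\<close> joins \<open>B0\<close>, and the double sum is used with the roles of
  \<open>A\<close> and \<open>B\<close> exchanged. Four signs combine: from exchanging the arguments
  of \<open>psc\<close>, from the double sum itself, and from reversing the order of the arguments in
  the two factors of the numerator.\<close>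

lemma G_cof_double_sum:
  fixes A0 B0 :: "'a::field multiset"
  assumes fin: "finite Ab" "finite Bb"
    and d: "size A0 + size B0 \<le> d" "d < size A0 + card Ab" "d < size B0 + card Bb"
  shows "G_cof d (root_poly (A0 + mset_set Ab)) (root_poly (B0 + mset_set Bb)) =
    (-1) ^ ((d - size A0) * (size A0 + card Ab - d - 1)) *
    (\<Sum>A' | A' \<subseteq> Ab \<and> card A' = d + 1 - size A0. \<Sum>B' | B' \<subseteq> Bb \<and> card B' = size A0.
      smult (mset_res (mset_set (Ab - A')) B0 * mset_res (A0 + mset_set (Ab - A')) (mset_set (Bb - B')) /
        (mset_res (mset_set A') (mset_set (Ab - A')) * mset_res (mset_set B') (mset_set (Bb - B'))))
      (root_poly (mset_set (Ab - A'))))"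
    (is "?G = ?R")
proof (rule poly_eqI_degree[of Ab])
  let ?f = "root_poly (A0 + mset_set Ab)" and ?g = "root_poly (B0 + mset_set Bb)"
  have deg: "degree ?f = size A0 + card Ab" "degree ?g = size B0 + card Bb"
    by (simp_all only: degree_root_poly size_union size_mset_set)
  have d': "d < degree ?f" "d < degree ?g" using d deg by simp_all
  have "degree ?G \<le> degree ?f - d - 1"
    by (rule degree_G_cof[OF d'])
  then show "degree ?G < card Ab"
    using d deg by linarith
  have "degree ?R \<le> size A0 + card Ab - d - 1"
  proof (rule degree_signed_double_sum, rule order.trans[OF degree_smult_le])
    fix A' assume "A' \<in> {A'. A' \<subseteq> Ab \<and> card A' = d + 1 - size A0}"
    then show "degree (root_poly (mset_set (Ab - A'))) \<le> size A0 + card Ab - d - 1"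
      using fin d by (auto simp: card_Diff_subset finite_subset)
  qed
  then show "degree ?R < card Ab"
    using d by linarith
next
  fix x
  let ?f = "root_poly (A0 + mset_set Ab)" and ?g = "root_poly (B0 + mset_set Bb)"
  let ?k = "d + 1" and ?m' = "size A0" and ?n' = "size B0"
  have deg: "degree ?f = size A0 + card Ab" "degree ?g = size B0 + card Bb"
    by (simp_all only: degree_root_poly size_union size_mset_set)
  have d': "d < degree ?f" "d < degree ?g" using d deg by simp_all
  let ?D = "\<lambda>A' B'. mset_res (mset_set A') (mset_set (Ab - A')) * mset_res (mset_set B') (mset_set (Bb - B'))"
  let ?t = "\<lambda>A' B'. mset_res (add_mset x B0) (mset_set (Ab - A')) * mset_res (mset_set (Bb - B')) (A0 + mset_set (Ab - A')) / ?D A' B'"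
  let ?u = "\<lambda>A' B'. mset_res (mset_set (Ab - A')) B0 * mset_res (A0 + mset_set (Ab - A')) (mset_set (Bb - B')) /
    ?D A' B' * poly (root_poly (mset_set (Ab - A'))) x"
  define s where "s = ?m' + card Ab - ?k"
  define e where "e = d - (?m' + ?n')"
  define v where "v = ?n' + card Bb - d"
  have de: "d = ?m' + ?n' + e" using d by (simp add: e_def)
  have cB: "card Bb = ?m' + e + v" using d by (simp add: v_def e_def)
  have cA: "card Ab = s + ?n' + e + 1" using d by (simp add: s_def e_def)
  have t: "(-1) ^ (s * v) * (-1) ^ (?m' * (card Bb - ?m')) * ?t A' B' = (-1) ^ ((d - ?m') * s) * ?u A' B'"
    if "A' \<subseteq> Ab" "card A' = ?k - ?m'" "B' \<subseteq> Bb" "card B' = ?m'" for A' B'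
  proof -
    have sA: "card (Ab - A') = s"
      using that fin de by (simp add: card_Diff_subset finite_subset cA)
    have sB: "card (Bb - B') = e + v"
      using that fin by (simp add: card_Diff_subset finite_subset cB)
    have 1: "mset_res B0 (mset_set (Ab - A')) = (-1) ^ (?n' * s) * mset_res (mset_set (Ab - A')) B0"
      using sA by (subst mset_res_commute) simp
    have 2: "mset_res (mset_set (Bb - B')) (A0 + mset_set (Ab - A')) =
        (-1) ^ ((e + v) * (?m' + s)) * mset_res (A0 + mset_set (Ab - A')) (mset_set (Bb - B'))"
      using sA sB by (subst mset_res_commute) (simp del: mset_res_simps)
    \<comment> \<open>Since \<open>d - |A0| = |B0| + e\<close>, the total exponent exceeds the stated one by an even
      number.\<close>
    have sum: "s * v + ?m' * (card Bb - ?m') + ?n' * s + (e + v) * (?m' + s) = (d - ?m') * s + 2 * (s * v + ?m' * (e + v))"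
      by (simp add: de cB algebra_simps)
    have "(-1 :: 'a) ^ (s * v) * (-1) ^ (?m' * (card Bb - ?m')) * (-1) ^ (?n' * s) * (-1) ^ ((e + v) * (?m' + s)) =
        (-1) ^ ((d - ?m') * s)"
      by (simp only: sum flip: power_add) (subst power_add, simp)
    moreover have "?t A' B' = (-1) ^ (?n' * s) * (-1) ^ ((e + v) * (?m' + s)) * ?u A' B'"
      unfolding 2 by (simp only: mset_res_simps(3) 1) (simp add: ac_simps)
    ultimately show ?thesis by (metis (no_types, lifting) mult.assoc)
  qed
  have "poly ?G x = psc ?k (A0 + mset_set Ab) (add_mset x B0 + mset_set Bb)"
    unfolding poly_G_cof[OF d'] deg using d by (simp add: psc_def)
  also have "\<dots> = (-1) ^ (s * v) * psc ?k (add_mset x B0 + mset_set Bb) (A0 + mset_set Ab)"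
    by (subst psc_swap) (simp add: s_def v_def)
  also have "\<dots> = (-1) ^ (s * v) * ((-1) ^ (?m' * (card Bb - ?m')) *
    (\<Sum>B' | B' \<subseteq> Bb \<and> card B' = ?m'. \<Sum>A' | A' \<subseteq> Ab \<and> card A' = ?k - ?m'. ?t A' B'))"
    using d by (subst psc_double_sum[OF fin(2,1)]) (auto simp: mult.commute)
  also have "\<dots> = (\<Sum>A' | A' \<subseteq> Ab \<and> card A' = ?k - ?m'. \<Sum>B' | B' \<subseteq> Bb \<and> card B' = ?m'.
      (-1) ^ (s * v) * (-1) ^ (?m' * (card Bb - ?m')) * ?t A' B')"
    by (subst sum.swap) (simp add: sum_distrib_left mult.assoc del: mset_res_simps)
  also have "\<dots> = (\<Sum>A' | A' \<subseteq> Ab \<and> card A' = ?k - ?m'. \<Sum>B' | B' \<subseteq> Bb \<and> card B' = ?m'.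
      (-1) ^ ((d - ?m') * s) * ?u A' B')"
    by (intro sum.cong refl t) auto
  also have "\<dots> = poly ?R x"
    by (simp add: poly_sum s_def sum_distrib_left ac_simps)
  finally show "poly ?G x = poly ?R x" .
qed

theorem theorem1p7:
  fixes f g :: "'a::field poly"
    and A B :: "'a multiset"
    and Ab Bb :: "'a set"
    and m n mb nb m' n' d :: nat
  assumes "lead_coeff f = 1" and "degree f = m" and "f = (\<Prod>a\<in>#A. [:- a, 1:])"
    and "lead_coeff g = 1" and "degree g = n" and "g = (\<Prod>b\<in>#B. [:- b, 1:])"
    and "Ab \<subseteq> set_mset A" and "Bb \<subseteq> set_mset B"
    and "mb = card Ab" and "nb = card Bb"
    and "m' = m - mb" and "n' = n - nb"
    and "m' + n' \<le> d" and "d < min m n"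
  shows
    "F_cof d f g =
       (-1) ^ (m - d + n' * (mb - 1)) *
       (\<Sum>A' | A' \<subseteq> Ab \<and> card A' = n'. \<Sum>B' | B' \<subseteq> Bb \<and> card B' = d + 1 - n'.
          smult
            (mset_res (A - mset_set Ab) (mset_set (Bb - B')) *
             mset_res (mset_set (Ab - A')) (B - mset_set B') /
             (mset_res (mset_set A') (mset_set (Ab - A')) *
              mset_res (mset_set B') (mset_set (Bb - B'))))
            (mset_res_var (mset_set (Bb - B'))))
   \<and>
    G_cof d f g =
       (-1) ^ ((d - m') * (m - d - 1)) *
       (\<Sum>A' | A' \<subseteq> Ab \<and> card A' = d + 1 - m'. \<Sum>B' | B' \<subseteq> Bb \<and> card B' = m'.
          smult
            (mset_res (mset_set (Ab - A')) (B - mset_set Bb) *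
             mset_res (A - mset_set A') (mset_set (Bb - B')) /
             (mset_res (mset_set A') (mset_set (Ab - A')) *
              mset_res (mset_set B') (mset_set (Bb - B'))))
            (mset_res_var (mset_set (Ab - A'))))"
proof -
  define A0 B0 where "A0 = A - mset_set Ab" and "B0 = B - mset_set Bb"
  have fin: "finite Ab" "finite Bb"
    using assms(7,8) by (auto intro: finite_subset)
  have "mset_set Ab \<subseteq># A" "mset_set Bb \<subseteq># B"
    using assms(7,8) fin by (auto simp: subset_eq intro!: mset_subset_eqI simp: count_mset_set')
  then have A: "A = A0 + mset_set Ab" and B: "B = B0 + mset_set Bb"
    by (simp_all add: A0_def B0_def)
  have f: "f = root_poly (A0 + mset_set Ab)" and g: "g = root_poly (B0 + mset_set Bb)"
    using assms(3,6) by (simp_all only: root_poly_def flip: A B)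
  have m: "m = size A0 + mb" and n: "n = size B0 + nb"
    using assms(2,5,9,10) f g by (simp_all only: degree_root_poly size_union size_mset_set)
  have m': "m' = size A0" and n': "n' = size B0"
    using assms(11,12) m n by simp_all
  have rest: "X - mset_set D = X0 + mset_set (Xb - D)"
    if "X = X0 + mset_set Xb" "finite Xb" "D \<subseteq> Xb" for X X0 :: "'a multiset" and D Xb
    unfolding that(1) mset_set_Diff_plus[OF that(2,3), symmetric] by simp
  have d: "size A0 + size B0 \<le> d" "d < size A0 + card Ab" "d < size B0 + card Bb"
    using assms(9,10,13,14) by (simp_all add: m' n' m n)
  show ?thesis
    unfolding f g F_cof_double_sum[OF fin d] G_cof_double_sum[OF fin d] mset_res_var_eq_root_poly
      A0_def[symmetric] B0_def[symmetric] m m' n' assms(9)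
    by (intro conjI arg_cong2[of _ _ _ _ "(*)"] refl sum.cong)
       (auto simp only: rest[OF A fin(1)] rest[OF B fin(2)])
qed

end
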